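(* Let $K=\mathbb{F}_q$ be a finite field, let $v_1,v_2,\ldots,v_n$ be positive integers, and let $X\subset\mathbb{P}^{n-1}$ be the degenerate projective torus parameterized by $x_1^{v_1},\ldots,x_n^{v_n}$, with vanishing ideal $I(X)\subset S=K[t_1,\ldots,t_n]$. If $n=3$, then $I(X)$ is minimally generated by at most $3$ binomials.
   Context: $X=\{[(x_1^{v_1},\ldots,x_n^{v_n})] : x_i\in K^*\text{ for all }i\}\subset\mathbb{P}^{n-1}$, where $\mathbb{P}^{n-1}$ is the projective space over $K$ and $K^*=K\setminus\{0\}$. $S=K[t_1,\ldots,t_n]$ has the standard grading, and $I(X)$ is the ideal of $S$ generated by the homogeneous polynomials that vanish at all points of $X$. A binomial is a polynomial of the form $t^a-t^b$ with $a,b\in\mathbb{N}^n$, where $t^a=t_1^{a_1}\cdots t_n^{a_n}$. *)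

theory Defs
  imports "HOL-Analysis.Cartesian_Space" "HOL-Library.Poly_Mapping"
begin

text \<open>
  Monomials \<open>t\<^sup>a\<close> with \<open>a \<in> \<nat>\<^sup>n\<close> are represented by their exponent vectors, and
  \<open>K[t\<^sub>1,\<dots>,t\<^sub>n]\<close> by the finitely supported coefficient functions on exponent
  vectors with the convolution product of \<^theory>\<open>HOL-Library.Poly_Mapping\<close>.
\<close>

type_synonym ('n, 'k) mpoly = "(nat ^ 'n) \<Rightarrow>\<^sub>0 'k"

definition monom_pow :: "nat ^ 'n \<Rightarrow> ('n::finite, 'k::comm_ring_1) mpoly" where
  "monom_pow a = Poly_Mapping.single a 1"

definition mdegree :: "nat ^ 'n \<Rightarrow> nat" where
  "mdegree a = (\<Sum>i\<in>UNIV. a $ i)"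

definition peval :: "('n::finite, 'k::comm_ring_1) mpoly \<Rightarrow> 'k ^ 'n \<Rightarrow> 'k" where
  "peval f x = (\<Sum>a\<in>Poly_Mapping.keys f. Poly_Mapping.lookup f a * (\<Prod>i\<in>UNIV. (x $ i) ^ (a $ i)))"

definition homogeneous :: "('n::finite, 'k::comm_ring_1) mpoly \<Rightarrow> bool" where
  "homogeneous f \<longleftrightarrow> (\<exists>d. \<forall>a\<in>Poly_Mapping.keys f. mdegree a = d)"

text \<open>The exponents may coincide, so zero counts as a binomial.\<close>

definition is_binomial :: "('n::finite, 'k::comm_ring_1) mpoly \<Rightarrow> bool" where
  "is_binomial f \<longleftrightarrow> (\<exists>a b. f = monom_pow a - monom_pow b)"

text \<open>An ideal is a submodule of the ring regarded as a module over itself.\<close>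

definition ideal_gen :: "'r::comm_ring_1 set \<Rightarrow> 'r set" where
  "ideal_gen B = module.span (*) B"

lemma module_self: "module ((*) :: 'r::comm_ring_1 \<Rightarrow> 'r \<Rightarrow> 'r)"
  by unfold_locales (simp_all add: algebra_simps)

definition minimally_generates :: "'r::comm_ring_1 set \<Rightarrow> 'r set \<Rightarrow> bool" where
  "minimally_generates B I \<longleftrightarrow> ideal_gen B = I \<and> (\<forall>C. C \<subset> B \<longrightarrow> ideal_gen C \<noteq> I)"

text \<open>
  Projective space over \<open>K\<close>: nonzero vectors up to nonzero scalars. A point is an
  equivalence class, that is, the set of all its homogeneous coordinate vectors.
\<close>

definition proj_rel :: "('k::field ^ 'n::finite) rel" where
  "proj_rel = {(x, y). x \<noteq> 0 \<and> y \<noteq> 0 \<and> (\<exists>c. c \<noteq> 0 \<and> y = c *s x)}"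

definition proj_space :: "('k::field ^ 'n::finite) set set" where
  "proj_space = {x. x \<noteq> 0} // proj_rel"

definition proj_point :: "'k::field ^ 'n::finite \<Rightarrow> ('k ^ 'n) set" where
  "proj_point x = proj_rel `` {x}"

definition degenerate_torus :: "('n::finite \<Rightarrow> nat) \<Rightarrow> ('k::field ^ 'n) set set" where
  "degenerate_torus v = {proj_point (\<chi> i. (x $ i) ^ v i) | x. \<forall>i. x $ i \<noteq> 0}"

definition vanishes_at :: "('n::finite, 'k::field) mpoly \<Rightarrow> ('k ^ 'n) set \<Rightarrow> bool" where
  "vanishes_at f P \<longleftrightarrow> (\<forall>x\<in>P. peval f x = 0)"

definition vanishing_ideal :: "('k::field ^ 'n::finite) set set \<Rightarrow> ('n, 'k) mpoly set" where
  "vanishing_ideal Y = ideal_gen {f. homogeneous f \<and> (\<forall>P\<in>Y. vanishes_at f P)}"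

lemma equiv_proj_rel: "equiv {x. x \<noteq> 0} (proj_rel :: ('k::field ^ 'n::finite) rel)"
proof (rule equivI)
  show "proj_rel \<subseteq> {x. x \<noteq> 0} \<times> {x :: 'k ^ 'n. x \<noteq> 0}"
    by (auto simp: proj_rel_def)
  show "refl_on {x. x \<noteq> 0} (proj_rel :: ('k ^ 'n) rel)"
    by (auto simp: refl_on_def proj_rel_def intro!: exI[of _ 1])
  show "sym (proj_rel :: ('k ^ 'n) rel)"
  proof (rule symI)
    fix x y :: "'k ^ 'n" assume "(x, y) \<in> proj_rel"
    then obtain c where "x \<noteq> 0" "y \<noteq> 0" "c \<noteq> 0" "y = c *s x"
      by (auto simp: proj_rel_def)
    then show "(y, x) \<in> proj_rel"
      by (auto simp: proj_rel_def vec_eq_iff intro!: exI[of _ "inverse c"])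
  qed
  show "trans (proj_rel :: ('k ^ 'n) rel)"
  proof (rule transI)
    fix x y z :: "'k ^ 'n" assume "(x, y) \<in> proj_rel" "(y, z) \<in> proj_rel"
    then obtain c d where "x \<noteq> 0" "z \<noteq> 0" "c \<noteq> 0" "d \<noteq> 0" "y = c *s x" "z = d *s y"
      by (auto simp: proj_rel_def)
    then show "(x, z) \<in> proj_rel"
      by (auto simp: proj_rel_def intro!: exI[of _ "d * c"])
  qed
qed

lemma degenerate_torus_subset: "degenerate_torus v \<subseteq> proj_space"
  by (auto simp: degenerate_torus_def proj_space_def proj_point_def vec_eq_iff
           intro!: quotientI)

end

theory Submission
  imports Defs
begin

text \<open>
  Homogeneous polynomials vanishing on the torus are, by orthogonality of characters, combinations of
  binomials \<open>t\<^sup>a - t\<^sup>b\<close> with \<open>a \<approx> b\<close>, where \<open>\<approx>\<close> is a cancellative congruence on exponent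
  vectors that preserves the degree. In three variables such a congruence is generated by three
  pairs: for each \<open>i\<close> take the least positive \<open>c\<close> such that \<open>c e\<^sub>i \<approx> r\<close> for some \<open>r\<close> not
  involving \<open>i\<close>. By induction on the degree one may cancel variables common to both sides; so
  one side is a pure power, and rewriting at most once on each side creates a common variable.
\<close>

section \<open>Exponent vectors and congruences on them in three variables\<close>

lemma third_element:
  assumes "CARD('n::finite) = 3" and "i \<noteq> (j::'n)"
  obtains k where "k \<noteq> i" "k \<noteq> j" "\<And>l. l = i \<or> l = j \<or> l = k"
proof -
  have "card (UNIV - {i, j}) = 1"
    using assms by (simp add: card_Diff_subset)
  then obtain k where "UNIV - {i, j} = {k}"
    by (auto simp: card_1_singleton_iff)
  then show ?thesis
    using that[of k] by blast
qed

lemma mdegree_add: "mdegree (a + b) = mdegree a + mdegree b"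
  by (simp add: mdegree_def sum.distrib)

lemma mdegree_axis [simp]: "mdegree (axis i m) = m"
  by (simp add: mdegree_def axis_def)

lemma mdegree_pos_iff: "mdegree a > 0 \<longleftrightarrow> (\<exists>i. a $ i > 0)"
  by (simp add: mdegree_def flip: neq0_conv)

lemma axis_add: "axis i (m + n) = axis i m + axis i (n :: 'a::monoid_add)"
  by (simp add: vec_eq_iff axis_def)

lemma split_axis:
  fixes a :: "nat ^ 'n::finite"
  assumes "a $ k > 0"
  obtains a' where "a = a' + axis k 1"
proof
  show "a = (\<chi> l. a $ l - (if l = k then 1 else 0)) + axis k 1"
    using assms by (simp add: vec_eq_iff axis_def)
qed

text \<open>The pair is \<open>(axis i c, r)\<close> with \<open>c\<close> the least exponent
  allowing such an \<open>r\<close>. If there is none, the trivial pair \<open>(0, 0)\<close> serves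
  and the second condition is vacuous. Thus every variable contributes exactly one pair.\<close>

lemma congruence_minimal_pair:
  fixes E :: "nat ^ 'n::finite \<Rightarrow> nat ^ 'n \<Rightarrow> bool"
  assumes "\<And>a. E a a"
  shows "\<exists>u w. E u w \<and> (\<forall>m b. m > 0 \<and> b $ i = 0 \<and> E (axis i m) b \<longrightarrow>
           (\<exists>c. u = axis i c \<and> 0 < c \<and> c \<le> m \<and> w $ i = 0))"
proof -
  define P where "P c \<longleftrightarrow> c > 0 \<and> (\<exists>r. r $ i = 0 \<and> E (axis i c) r)" for c
  show ?thesis
  proof (cases "\<exists>c. P c")
    case True
    then have "P (LEAST c. P c)"
      by (metis LeastI)
    then obtain r where "r $ i = 0" "E (axis i (LEAST c. P c)) r" "(LEAST c. P c) > 0"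
      by (auto simp: P_def)
    then show ?thesis
      by (intro exI[of _ "axis i (LEAST c. P c)"] exI[of _ r]) (auto simp: P_def intro!: Least_le)
  next
    case False
    then show ?thesis
      using assms[of 0] by (intro exI[of _ 0]) (auto simp: P_def)
  qed
qed

text \<open>Generation is phrased as a universal property over all shift-stable equivalences
  \<open>R\<close>, so that \<open>R\<close> can later be membership of a binomial in an ideal. As
  \<open>R\<close> need not lie inside \<open>E\<close>, the induction has to track both
  relations.\<close>

lemma graded_congruence_generators:
  fixes E :: "nat ^ 'n::finite \<Rightarrow> nat ^ 'n \<Rightarrow> bool"
  assumes card: "CARD('n) = 3" and "equivp E"
    and shift: "\<And>a b c. E (a + c) (b + c) \<longleftrightarrow> E a b"
    and deg: "\<And>a b. E a b \<Longrightarrow> mdegree a = mdegree b"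
  obtains u w where "\<And>i. E (u i) (w i)"
    and "\<And>R a b. \<lbrakk>equivp R; \<And>a b c. R a b \<Longrightarrow> R (a + c) (b + c); \<And>i::'n. R (u i) (w i);
                   E a b\<rbrakk> \<Longrightarrow> R a b"
proof -
  note E_refl = equivp_reflp[OF \<open>equivp E\<close>] and E_sym = equivp_symp[OF \<open>equivp E\<close>]
    and E_trans = equivp_transp[OF \<open>equivp E\<close>]
  obtain u w where uw: "\<And>i. E (u i) (w i)"
    and least: "\<And>i m b. \<lbrakk>m > 0; b $ i = 0; E (axis i m) b\<rbrakk> \<Longrightarrow>
                  \<exists>c. u i = axis i c \<and> 0 < c \<and> c \<le> m \<and> w i $ i = 0"
    using congruence_minimal_pair[of E, OF E_refl] by metis
  have "R a b"
    if "equivp R" and R_shift: "\<And>a b c. R a b \<Longrightarrow> R (a + c) (b + c)"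
      and R_uw: "\<And>i. R (u i) (w i)" and "E a b" for R a b
    using \<open>E a b\<close>
  proof (induction "mdegree a" arbitrary: a b rule: less_induct)
    case less
    note R_refl = equivp_reflp[OF \<open>equivp R\<close>] and R_sym = equivp_symp[OF \<open>equivp R\<close>]
      and R_trans = equivp_transp[OF \<open>equivp R\<close>]
    \<comment> \<open>Replace \<open>x\<close>, \<open>y\<close> by \<open>x'\<close>,
      \<open>y'\<close> with a common variable and cancel it. Cancellation in \<open>E\<close>
      yields an equivalent pair of smaller degree for the induction hypothesis, and \<open>R\<close>
      is carried back by shifting and transitivity.\<close>
    have share: "R x y"
      if xy: "E x y" "mdegree x = mdegree a" "E x x'" "R x x'" "E y y'" "R y y'" and pos: "x' $ k > 0" "y' $ k > 0"
      for x y x' y' k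
    proof -
      obtain x'' y'' where eq: "x' = x'' + axis k 1" "y' = y'' + axis k 1"
        using split_axis pos by metis
      have "E x' y'"
        using E_trans E_sym xy by blast
      then have "E x'' y''"
        unfolding eq shift .
      moreover have "mdegree x'' < mdegree a"
        using deg[OF \<open>E x x'\<close>] xy(2) by (simp add: eq mdegree_add)
      ultimately have "R x' y'"
        unfolding eq using less.hyps R_shift by blast
      then show ?thesis
        using R_trans R_sym xy by blast
    qed
    \<comment> \<open>Since \<open>c \<le> m\<close>, the factor \<open>axis i c\<close> is replaced
      by \<open>w i\<close>, and the rest is \<open>s = axis i (m - c)\<close>. The new factor has
      degree \<open>c > 0\<close> and omits \<open>i\<close>, so it brings in another
      variable.\<close>
    have rewrite: "\<exists>s. E (axis i m) (w i + s) \<and> R (axis i m) (w i + s) \<and> w i $ i = 0 \<and> mdegree (w i) > 0"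
      if m: "m > 0" "y $ i = 0" "E (axis i m) y" for i m y
    proof -
      obtain c where c: "u i = axis i c" "0 < c" "c \<le> m" "w i $ i = 0"
        using least[OF m] by blast
      have "axis i m = u i + axis i (m - c)"
        using c by (simp flip: axis_add)
      moreover have "mdegree (w i) = c"
        using deg[OF uw[of i]] c by simp
      ultimately show ?thesis
        using c uw R_uw R_shift shift by metis
    qed
    \<comment> \<open>Rewriting \<open>x\<close> brings in some \<open>k \<noteq> i\<close>. If
      \<open>y\<close> omits \<open>k\<close> as well, it is a power of the third variable
      \<open>j\<close>, and rewriting it brings in \<open>l \<noteq> j\<close>. For
      \<open>l = i\<close> it meets the original \<open>x\<close>, for \<open>l = k\<close> the
      rewritten one.\<close>
    have pure: "R x y"
      if xy: "E x y" "mdegree x = mdegree a" "x = axis i m" "m > 0" "y $ i = 0" for x y i m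
    proof -
      obtain s where s: "E x (w i + s)" "R x (w i + s)" "w i $ i = 0" "mdegree (w i) > 0"
        using rewrite xy by blast
      obtain k where k: "w i $ k > 0" "k \<noteq> i"
        using s(3,4) by (metis mdegree_pos_iff less_irrefl)
      show ?thesis
      proof (cases "y $ k > 0")
        case True
        then show ?thesis
          using k s that by (intro share[of x y "w i + s" y k] E_refl R_refl) auto
      next
        case False
        obtain j where j: "j \<noteq> k" "j \<noteq> i" "\<And>l. l = k \<or> l = i \<or> l = j"
          using third_element[OF card k(2)] by blast
        have y: "y = axis j (y $ j)"
          using j False \<open>y $ i = 0\<close> by (auto simp: vec_eq_iff axis_def) (metis j(3))
        have "y $ j > 0"
          using deg[OF \<open>E x y\<close>] that y by (metis mdegree_axis)
        moreover have "x $ j = 0" "E (axis j (y $ j)) x"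
          using that j y E_sym by (auto simp: axis_def)
        ultimately obtain s' where s': "E y (w j + s')" "R y (w j + s')" "w j $ j = 0" "mdegree (w j) > 0"
          using rewrite y by metis
        obtain l where l: "w j $ l > 0" "l \<noteq> j"
          using s'(3,4) by (metis mdegree_pos_iff less_irrefl)
        show ?thesis
        proof (cases "l = i")
          case True
          then show ?thesis
            using l s' that by (intro share[of x y x "w j + s'" i] E_refl R_refl) (auto simp: axis_def)
        next
          case False
          then have "l = k"
            using j l by blast
          then show ?thesis
            using l k s s' that by (intro share[of x y "w i + s" "w j + s'" k]) auto
        qed
      qed
    qed
    show ?case
    proof (cases "\<exists>k. a $ k > 0 \<and> b $ k > 0")
      case True
      then show ?thesis
        using share less.prems E_refl R_refl by blast
    next
      case disjoint: False
      show ?thesis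
      proof (cases "mdegree a = 0")
        case True
        moreover have "mdegree b = 0"
          using True deg[OF less.prems] by simp
        ultimately have "\<forall>i. a $ i = b $ i"
          using mdegree_pos_iff[of a] mdegree_pos_iff[of b] by auto
        then have "a = b"
          by (simp add: vec_eq_iff)
        then show ?thesis
          using R_refl by simp
      next
        case False
        then obtain i where i: "a $ i > 0"
          using mdegree_pos_iff[of a] by auto
        show ?thesis
        proof (cases "\<exists>j. j \<noteq> i \<and> a $ j > 0")
          case False
          then have "a = axis i (a $ i)"
            by (auto simp: vec_eq_iff axis_def)
          moreover have "b $ i = 0"
            using i disjoint by (metis not_gr_zero)
          ultimately show ?thesis
            using pure[OF less.prems refl _ i] by blast
        next
          case True
          then obtain j where j: "j \<noteq> i" "a $ j > 0"
            by blast
          obtain k where k: "k \<noteq> j" "k \<noteq> i" "\<And>l. l = j \<or> l = i \<or> l = k"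
            using third_element[OF card j(1)] by blast
          \<comment> \<open>With two variables occurring in \<open>a\<close>, disjointness leaves
            only the third for \<open>b\<close>, so \<open>pure\<close> applies with the sides
            exchanged.\<close>
          have b: "b = axis k (b $ k)"
            using k i j disjoint by (auto simp: vec_eq_iff axis_def) (metis k(3) not_gr_zero)
          have "b $ k > 0"
            using deg[OF less.prems] b False by (metis mdegree_axis not_gr_zero)
          moreover from this have "a $ k = 0"
            using disjoint by (metis not_gr_zero)
          ultimately have "R b a"
            using pure[OF E_sym[OF less.prems] deg[OF less.prems, symmetric] b] by blast
          then show ?thesis
            using R_sym by blast
        qed
      qed
    qed
  qed
  then show ?thesis
    using that uw by blast
qed

section \<open>Ideals, minimal generation and membership of combinations of binomials\<close>

global_interpretation ideal: module "(*) :: 'r::comm_ring_1 \<Rightarrow> 'r \<Rightarrow> 'r"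
  rewrites "module.span (*) = (ideal_gen :: 'r set \<Rightarrow> 'r set)"
  by (rule module_self) (simp add: ideal_gen_def fun_eq_iff)

lemma minimally_generates_subset:
  assumes "finite B"
  obtains C where "C \<subseteq> B" "minimally_generates C (ideal_gen B)"
  using assms
proof (induction B arbitrary: thesis rule: finite_psubset_induct)
  case (psubset B)
  show ?case
  proof (cases "\<exists>C. C \<subset> B \<and> ideal_gen C = ideal_gen B")
    case True
    then obtain C where "C \<subset> B" "ideal_gen C = ideal_gen B"
      by blast
    then show ?thesis
      using psubset.IH[of C] psubset.prems by (metis order_trans psubset_imp_subset)
  next
    case False
    then show ?thesis
      using psubset.prems[of B] by (auto simp: minimally_generates_def)
  qed
qed

lemma monom_pow_add: "monom_pow (a + b) = monom_pow a * monom_pow b"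
  by (simp add: monom_pow_def mult_single)

lemma sum_monomials: "f = (\<Sum>a\<in>Poly_Mapping.keys f. Poly_Mapping.single 0 (Poly_Mapping.lookup f a) * monom_pow a)"
  by (rule poly_mapping_eqI)
    (simp add: monom_pow_def mult_single lookup_sum lookup_single when_def in_keys_iff)

text \<open>Replacing each monomial of \<open>f\<close> by a representative of its class gives zero,
  because the coefficients in each class cancel. Hence \<open>f\<close> equals the sum of its
  coefficients times the differences between monomial and representative.\<close>

lemma mem_ideal_if_class_sums_zero:
  fixes f :: "('n::finite, 'k::field) mpoly"
  assumes "equivp E" and J: "\<And>a b. E a b \<Longrightarrow> monom_pow a - monom_pow b \<in> ideal_gen B"
    and zero: "\<And>b. (\<Sum>a | a \<in> Poly_Mapping.keys f \<and> E a b. Poly_Mapping.lookup f a) = 0"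
  shows "f \<in> ideal_gen B"
proof -
  define c :: "'k \<Rightarrow> ('n, 'k) mpoly" where "c = Poly_Mapping.single 0"
  \<comment> \<open>The choice depends on \<open>a\<close> only through the predicate
    \<open>E a\<close>, so equivalent vectors get the same representative.\<close>
  define \<rho> where "\<rho> a = (SOME b. E a b)" for a
  let ?A = "Poly_Mapping.keys f" and ?f = "Poly_Mapping.lookup f"
  have c_sum: "c (sum g S) = (\<Sum>a\<in>S. c (g a))" for g and S :: "(nat ^ 'n) set"
    by (rule poly_mapping_eqI) (simp add: c_def lookup_sum lookup_single when_def)
  have E\<rho>: "E a (\<rho> a)" for a
    unfolding \<rho>_def using equivp_reflp[OF \<open>equivp E\<close>] by (rule someI)
  have \<rho>_eq: "\<rho> a = \<rho> b \<longleftrightarrow> E a b" for a b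
  proof
    assume "E a b"
    then have "E a = E b"
      using \<open>equivp E\<close> by (simp add: equivp_def)
    then show "\<rho> a = \<rho> b"
      by (simp add: \<rho>_def)
  next
    assume "\<rho> a = \<rho> b"
    then show "E a b"
      using E\<rho>[of a] E\<rho>[of b] equivp_symp[OF \<open>equivp E\<close>] equivp_transp[OF \<open>equivp E\<close>] by metis
  qed
  have "(\<Sum>a\<in>?A. c (?f a) * monom_pow (\<rho> a)) = (\<Sum>b\<in>\<rho> ` ?A. \<Sum>a | a \<in> ?A \<and> \<rho> a = b. c (?f a) * monom_pow (\<rho> a))"
    by (rule sum.image_gen) simp
  also have "\<dots> = 0"
  proof (rule sum.neutral, clarify)
    fix b assume "b \<in> ?A"
    have "(\<Sum>a | a \<in> ?A \<and> \<rho> a = \<rho> b. c (?f a) * monom_pow (\<rho> a))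
        = c (\<Sum>a | a \<in> ?A \<and> E a b. ?f a) * monom_pow (\<rho> b)"
      by (auto simp: c_sum sum_distrib_right simp flip: \<rho>_eq intro!: sum.cong)
    then show "(\<Sum>a | a \<in> ?A \<and> \<rho> a = \<rho> b. c (?f a) * monom_pow (\<rho> a)) = 0"
      by (simp add: zero c_def)
  qed
  finally have "f = (\<Sum>a\<in>?A. c (?f a) * (monom_pow a - monom_pow (\<rho> a)))"
    using sum_monomials[of f] by (simp add: c_def right_diff_distrib sum_subtractf)
  also have "\<dots> \<in> ideal_gen B"
    by (intro ideal.span_sum ideal.span_scale J E\<rho>)
  finally show ?thesis .
qed

section \<open>Character sums over the finite field and the congruence of the torus\<close>

lemma of_nat_CARD_eq_0: "of_nat CARD('k) = (0 :: 'k::{ring_1, finite})"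
proof -
  \<comment> \<open>Translation by 1 permutes the ring, so the ones added in total sum to
    zero.\<close>
  have "(\<Sum>y\<in>UNIV. y) = (\<Sum>y\<in>UNIV. y + (1::'k))"
    by (rule sum.reindex_bij_witness[of _ "\<lambda>y. y + 1" "\<lambda>y. y - 1"]) auto
  then show ?thesis
    by (simp add: sum.distrib)
qed

text \<open>Orthogonality for the character \<open>y ^ m / y ^ n\<close> of the unit group. A
  trivial character sums to q - 1, which is -1 in the field. Otherwise substituting
  \<open>z * y\<close> multiplies the sum by a factor different from 1.\<close>

lemma sum_power_quotient:
  "(\<Sum>y\<in>-{0::'k::{field, finite}}. y ^ m / y ^ n) = (if \<forall>y::'k. y \<noteq> 0 \<longrightarrow> y ^ m = y ^ n then -1 else 0)"
proof (cases "\<forall>y::'k. y \<noteq> 0 \<longrightarrow> y ^ m = y ^ n")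
  case True
  then have "(\<Sum>y\<in>-{0::'k}. y ^ m / y ^ n) = (\<Sum>y\<in>-{0::'k}. 1)"
    by (intro sum.cong) auto
  also have "\<dots> = -1"
    by (simp add: Compl_eq_Diff_UNIV card_Diff_subset of_nat_diff Suc_leI of_nat_CARD_eq_0)
  finally show ?thesis
    using True by simp
next
  case False
  then obtain z :: 'k where z: "z \<noteq> 0" "z ^ m \<noteq> z ^ n"
    by blast
  let ?S = "\<Sum>y\<in>-{0::'k}. y ^ m / y ^ n"
  have "?S = (\<Sum>y\<in>-{0::'k}. (z * y) ^ m / (z * y) ^ n)"
    by (rule sum.reindex_bij_witness[of _ "\<lambda>y. z * y" "\<lambda>y. y / z"]) (use z in auto)
  also have "\<dots> = z ^ m / z ^ n * ?S"
    by (simp add: power_mult_distrib sum_distrib_left)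
  finally have "(z ^ m / z ^ n - 1) * ?S = 0"
    by (simp add: algebra_simps)
  then have "?S = 0"
    using z by simp
  then show ?thesis
    using False by (simp only: if_False)
qed

text \<open>Over a field with q elements the second condition says that \<open>v i * a $ i\<close>
  and \<open>v i * b $ i\<close> agree modulo q - 1; in terms of powers, it needs no appeal to the
  cyclicity of the unit group. The type argument supplies the field, which exponent vectors do not
  determine.\<close>

definition torus_equiv :: "'k::field itself \<Rightarrow> ('n::finite \<Rightarrow> nat) \<Rightarrow> nat ^ 'n \<Rightarrow> nat ^ 'n \<Rightarrow> bool" where
  "torus_equiv _ v a b \<longleftrightarrow>
     mdegree a = mdegree b \<and> (\<forall>i. \<forall>y::'k. y \<noteq> 0 \<longrightarrow> y ^ (v i * a $ i) = y ^ (v i * b $ i))"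

lemma equivp_torus_equiv: "equivp (torus_equiv TYPE('k::field) v)"
  by (rule equivpI) (auto simp: torus_equiv_def reflp_def symp_def transp_def)

lemma torus_equiv_shift:
  "torus_equiv TYPE('k::field) v (a + c) (b + c) \<longleftrightarrow> torus_equiv TYPE('k) v a b"
  by (auto simp: torus_equiv_def mdegree_add distrib_left power_add)

lemma peval_binomial:
  fixes x :: "'k::field ^ 'n::finite"
  shows "peval (monom_pow a - monom_pow b) x = (\<Prod>i\<in>UNIV. x $ i ^ a $ i) - (\<Prod>i\<in>UNIV. x $ i ^ b $ i)"
proof (cases "a = b")
  case False
  then have "Poly_Mapping.keys (monom_pow a - monom_pow b :: ('n, 'k) mpoly) = {a, b}"
    by (auto simp: monom_pow_def in_keys_iff lookup_minus lookup_single when_def split: if_splits)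
  with False show ?thesis
    by (simp add: peval_def monom_pow_def lookup_minus lookup_single when_def)
qed (simp add: peval_def)

lemma torus_equiv_vanishes:
  fixes v :: "'n::finite \<Rightarrow> nat"
  assumes E: "torus_equiv TYPE('k::field) v a b" and P: "P \<in> degenerate_torus v"
  shows "vanishes_at (monom_pow a - monom_pow b :: ('n, 'k) mpoly) P"
proof -
  from P obtain x :: "'k ^ 'n" where x: "P = proj_point (\<chi> i. (x $ i) ^ v i)" "\<And>i. x $ i \<noteq> 0"
    by (auto simp: degenerate_torus_def)
  \<comment> \<open>A projective point contains all multiples of its coordinate vector; the scalar
    \<open>s\<close> comes out as a power depending only on the degree.\<close>
  have eval: "(\<Prod>i\<in>UNIV. (s * x $ i ^ v i) ^ e $ i) = s ^ mdegree e * (\<Prod>i\<in>UNIV. x $ i ^ (v i * e $ i))"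
    for s and e :: "nat ^ 'n"
    by (simp add: power_mult_distrib prod.distrib mdegree_def power_sum flip: power_mult)
  have "(\<Prod>i\<in>UNIV. (s * x $ i ^ v i) ^ a $ i) = (\<Prod>i\<in>UNIV. (s * x $ i ^ v i) ^ b $ i)" for s
    unfolding eval using E x by (simp add: torus_equiv_def)
  then show ?thesis
    by (auto simp: vanishes_at_def x proj_point_def proj_rel_def peval_binomial)
qed

lemma homogeneous_binomial: "mdegree a = mdegree b \<Longrightarrow> homogeneous (monom_pow a - monom_pow b)"
  unfolding homogeneous_def
  by (rule exI[of _ "mdegree a"])
    (auto simp: monom_pow_def in_keys_iff lookup_minus lookup_single when_def split: if_splits)

text \<open>Divide the values of \<open>f\<close> on the torus by those of the monomial
  \<open>b\<close> and sum over all parameters. The sum factors into one character sum per variable,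
  which singles out the class of \<open>b\<close> up to a sign.\<close>

lemma class_sum_eq_0:
  fixes f :: "('n::finite, 'k::{field, finite}) mpoly"
  assumes hom: "homogeneous f" and van: "\<And>P. P \<in> degenerate_torus v \<Longrightarrow> vanishes_at f P"
  shows "(\<Sum>a | a \<in> Poly_Mapping.keys f \<and> torus_equiv TYPE('k) v a b. Poly_Mapping.lookup f a) = 0"
proof -
  let ?A = "Poly_Mapping.keys f" and ?f = "Poly_Mapping.lookup f"
  obtain d where d: "\<And>a. a \<in> ?A \<Longrightarrow> mdegree a = d"
    using hom by (auto simp: homogeneous_def)
  show ?thesis
  proof (cases "mdegree b = d")
    case False
    then have "{a. a \<in> ?A \<and> torus_equiv TYPE('k) v a b} = {}"
      using d by (auto simp: torus_equiv_def)
    then show ?thesis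
      by (metis sum.empty)
  next
    case True
    \<comment> \<open>Parameters are functions rather than vectors, so that
      \<open>prod_sum_PiE\<close> can exchange sum and product.\<close>
    let ?T = "PiE (UNIV :: 'n set) (\<lambda>_. -{0::'k})"
    let ?g = "\<lambda>a i y. y ^ (v i * a $ i) / y ^ (v i * b $ i) :: 'k"
    have vanish: "(\<Sum>a\<in>?A. ?f a * (\<Prod>i\<in>UNIV. x i ^ (v i * a $ i))) = 0" if "x \<in> ?T" for x
    proof -
      let ?y = "\<chi> i. x i"
      have nz: "x i \<noteq> 0" for i
        using that by (auto simp: PiE_iff)
      then have "proj_point (\<chi> i. (?y $ i) ^ v i) \<in> degenerate_torus v"
        unfolding degenerate_torus_def by (intro CollectI exI[of _ ?y]) simp
      then have "vanishes_at f (proj_point (\<chi> i. (?y $ i) ^ v i))"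
        by (rule van)
      moreover have "(\<chi> i. (?y $ i) ^ v i) \<noteq> 0"
        using nz by (simp add: vec_eq_iff)
      then have "(\<chi> i. (?y $ i) ^ v i) \<in> proj_point (\<chi> i. (?y $ i) ^ v i)"
        unfolding proj_point_def proj_rel_def by (auto intro!: exI[of _ 1])
      ultimately have "peval f (\<chi> i. (?y $ i) ^ v i) = 0"
        by (auto simp: vanishes_at_def)
      then show ?thesis
        by (simp add: peval_def flip: power_mult)
    qed
    have "0 = (\<Sum>x\<in>?T. (\<Sum>a\<in>?A. ?f a * (\<Prod>i\<in>UNIV. x i ^ (v i * a $ i))) / (\<Prod>i\<in>UNIV. x i ^ (v i * b $ i)))"
      by (simp add: vanish)
    also have "\<dots> = (\<Sum>a\<in>?A. ?f a * (\<Sum>x\<in>?T. \<Prod>i\<in>UNIV. ?g a i (x i)))"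
      by (simp add: sum_divide_distrib sum_distrib_left prod_dividef sum.swap[of _ ?A])
    also have "\<dots> = (\<Sum>a\<in>?A. ?f a * (\<Prod>i\<in>UNIV. \<Sum>y\<in>-{0}. ?g a i y))"
      by (simp add: prod_sum_PiE)
    also have "\<dots> = (\<Sum>a\<in>?A. if torus_equiv TYPE('k) v a b then ?f a * (-1) ^ CARD('n) else 0)"
    proof (rule sum.cong)
      \<comment> \<open>All keys have degree \<open>d\<close>, as does \<open>b\<close>, so only the
        power condition of \<open>torus_equiv\<close> is at stake.\<close>
      fix a assume a: "a \<in> ?A"
      show "?f a * (\<Prod>i\<in>UNIV. \<Sum>y\<in>-{0}. ?g a i y)
          = (if torus_equiv TYPE('k) v a b then ?f a * (-1) ^ CARD('n) else 0)"
        unfolding sum_power_quotient torus_equiv_def using d[OF a] True by auto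
    qed simp
    also have "\<dots> = (\<Sum>a | a \<in> ?A \<and> torus_equiv TYPE('k) v a b. ?f a) * (-1) ^ CARD('n)"
      by (auto simp: sum.inter_filter sum_distrib_right intro!: sum.cong)
    finally show ?thesis
      by simp
  qed
qed

theorem corollary3p4:
  fixes v :: "'n::finite \<Rightarrow> nat"
    and X :: "('k::{field, finite} ^ 'n) set set"
  assumes "\<And>i. v i > 0"
    and "X = degenerate_torus v"
    and "CARD('n) = 3"
  shows "\<exists>B. finite B \<and> card B \<le> 3 \<and> (\<forall>f\<in>B. is_binomial f) \<and>
             minimally_generates B (vanishing_ideal X)"
proof -
  let ?E = "torus_equiv TYPE('k) v"
  have deg: "mdegree a = mdegree b" if "?E a b" for a b
    using that by (simp add: torus_equiv_def)
  obtain u w where uw: "\<And>i. ?E (u i) (w i)"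
    and gen: "\<And>R a b. \<lbrakk>equivp R; \<And>a b c. R a b \<Longrightarrow> R (a + c) (b + c); \<And>i::'n. R (u i) (w i);
                   ?E a b\<rbrakk> \<Longrightarrow> R a b"
    by (rule graded_congruence_generators[of ?E, OF assms(3) equivp_torus_equiv torus_equiv_shift deg]) blast+
  \<comment> \<open>One binomial per variable. Some may coincide or be zero, from trivial pairs;
    passing to a minimal generating subset removes such redundancy at the end.\<close>
  define B :: "('n, 'k) mpoly set" where "B = range (\<lambda>i. monom_pow (u i) - monom_pow (w i))"
  have "finite B" and "card B \<le> 3"
    using card_image_le[of UNIV "\<lambda>i. monom_pow (u i) - monom_pow (w i) :: ('n, 'k) mpoly"] assms(3)
    by (auto simp: B_def)
  have J: "monom_pow a - monom_pow b \<in> ideal_gen B" if "?E a b" for a b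
  \<comment> \<open>Membership of the binomial in \<open>ideal_gen B\<close> is itself a
    shift-stable equivalence: transitivity is a telescoping sum, and a shift is multiplication by a
    monomial.\<close>
  proof (rule gen[of "\<lambda>a b. monom_pow a - monom_pow b \<in> ideal_gen B", OF _ _ _ that])
    show "equivp (\<lambda>a b. monom_pow a - monom_pow b \<in> ideal_gen B)"
    proof (rule equivpI)
      show "reflp (\<lambda>a b. monom_pow a - monom_pow b \<in> ideal_gen B)"
        by (simp add: reflp_def ideal.span_zero)
      show "symp (\<lambda>a b. monom_pow a - monom_pow b \<in> ideal_gen B)"
        by (rule sympI) (metis ideal.span_neg minus_diff_eq)
      show "transp (\<lambda>a b. monom_pow a - monom_pow b \<in> ideal_gen B)"
      proof (rule transpI)
        fix a b c :: "nat ^ 'n"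
        assume "monom_pow a - monom_pow b \<in> ideal_gen B" "monom_pow b - monom_pow c \<in> ideal_gen B"
        from ideal.span_add[OF this] show "monom_pow a - monom_pow c \<in> ideal_gen B"
          by simp
      qed
    qed
    show "monom_pow (a + c) - monom_pow (b + c) \<in> ideal_gen B"
      if "monom_pow a - monom_pow b \<in> ideal_gen B" for a b c
      using ideal.span_scale[OF that, of "monom_pow c"]
      by (simp add: monom_pow_add algebra_simps)
    show "monom_pow (u i) - monom_pow (w i) \<in> ideal_gen B" for i
      by (rule ideal.span_base) (simp add: B_def)
  qed
  have "vanishing_ideal X = ideal_gen B"
  proof
    show "vanishing_ideal X \<subseteq> ideal_gen B"
      unfolding vanishing_ideal_def assms(2)
    proof (intro ideal.span_minimal ideal.subspace_span subsetI)
      fix f :: "('n, 'k) mpoly"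
      assume "f \<in> {f. homogeneous f \<and> (\<forall>P\<in>degenerate_torus v. vanishes_at f P)}"
      then show "f \<in> ideal_gen B"
        by (intro mem_ideal_if_class_sums_zero[of ?E, OF equivp_torus_equiv J class_sum_eq_0]) auto
    qed
    show "ideal_gen B \<subseteq> vanishing_ideal X"
      unfolding vanishing_ideal_def assms(2)
      by (rule ideal.span_mono)
        (auto simp: B_def intro!: homogeneous_binomial deg[OF uw] torus_equiv_vanishes[OF uw])
  qed
  moreover obtain C where "C \<subseteq> B" "minimally_generates C (ideal_gen B)"
    using minimally_generates_subset[OF \<open>finite B\<close>] by blast
  moreover have "\<forall>f\<in>B. is_binomial f"
    by (auto simp: B_def is_binomial_def)
  ultimately show ?thesis
    using \<open>finite B\<close> \<open>card B \<le> 3\<close> by (metis card_mono finite_subset order_trans subsetD)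
qed

end
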